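(* Let $R$ be a finite local commutative ring which is not a field and satisfies $\mathrm{rad}(R)^2=\{0\}$, and let $K\le R^\times$. Then the cyclotomic scheme $\mathrm{Cyc}(K,R)$ is normal whenever $K$ is pure.
   Context: All rings have an identity. For a finite local commutative ring $R$, $\mathrm{rad}(R)$ is its unique maximal ideal. For a subgroup $K$ of $R^\times$, the cyclotomic scheme $\mathrm{Cyc}(K,R)$ is the pair $(R,\mathrm{Rel}(K,R))$, where $\mathrm{Rel}(K,R)$ is the set of binary relations $\{(x,y)\in R\times R:\ y-x\in rK\}$, $r\in R$. Its automorphism group $\mathrm{Aut}(\mathcal C)$ is the group of permutations $f$ of $R$ with $S^f=S$ for all $S\in\mathrm{Rel}(K,R)$. $\mathrm{A\Gamma L}_1(R)$ is the group of permutations $x\mapsto ax^\sigma+b$ with $a\in R^\times$, $b\in R$, $\sigma\in\mathrm{Aut}(R)$; the scheme is normal if $\mathrm{Aut}(\mathcal C)\le\mathrm{A\Gamma L}_1(R)$. A group $K\le R^\times$ is pure if the only ideal $I$ of $R$ with $1+I\subseteq K$ is $I=\{0\}$. *)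

theory Defs
  imports Main
begin

definition is_ideal :: "'a::comm_ring_1 set \<Rightarrow> bool" where
  "is_ideal I \<longleftrightarrow> 0 \<in> I \<and> (\<forall>x\<in>I. \<forall>y\<in>I. x + y \<in> I) \<and> (\<forall>x\<in>I. - x \<in> I)
     \<and> (\<forall>r. \<forall>x\<in>I. r * x \<in> I)"

definition maximal_ideal :: "'a::comm_ring_1 set \<Rightarrow> bool" where
  "maximal_ideal M \<longleftrightarrow> is_ideal M \<and> M \<noteq> UNIV \<and>
     (\<forall>J. is_ideal J \<and> M \<subseteq> J \<longrightarrow> J = M \<or> J = UNIV)"

definition local_ring :: "'a::comm_ring_1 itself \<Rightarrow> bool" where
  "local_ring _ \<longleftrightarrow> (\<exists>!M::'a set. maximal_ideal M)"

definition rad :: "'a::comm_ring_1 set" where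
  "rad = (THE M. maximal_ideal M)"

definition is_field_ring :: "'a::comm_ring_1 itself \<Rightarrow> bool" where
  "is_field_ring _ \<longleftrightarrow> (0::'a) \<noteq> 1 \<and> (\<forall>x::'a. x \<noteq> 0 \<longrightarrow> x dvd 1)"

definition ideal_prod :: "'a::comm_ring_1 set \<Rightarrow> 'a set \<Rightarrow> 'a set" where
  "ideal_prod I J = \<Inter>{L. is_ideal L \<and> (\<forall>x\<in>I. \<forall>y\<in>J. x * y \<in> L)}"

definition ring_units :: "'a::comm_ring_1 set" where
  "ring_units = {x. x dvd 1}"

definition units_subgroup :: "'a::comm_ring_1 set \<Rightarrow> bool" where
  "units_subgroup K \<longleftrightarrow> K \<subseteq> ring_units \<and> 1 \<in> K \<and> (\<forall>x\<in>K. \<forall>y\<in>K. x * y \<in> K)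
     \<and> (\<forall>x\<in>K. \<exists>y\<in>K. x * y = 1)"

definition pure :: "'a::comm_ring_1 set \<Rightarrow> bool" where
  "pure K \<longleftrightarrow> (\<forall>I. is_ideal I \<and> (\<forall>i\<in>I. 1 + i \<in> K) \<longrightarrow> I = {0})"

definition cyc_rel :: "'a::comm_ring_1 set \<Rightarrow> 'a \<Rightarrow> ('a \<times> 'a) set" where
  "cyc_rel K r = {(x, y). y - x \<in> (\<lambda>k. r * k) ` K}"

definition cyc_rels :: "'a::comm_ring_1 set \<Rightarrow> ('a \<times> 'a) set set" where
  "cyc_rels K = range (cyc_rel K)"

definition cyc_aut :: "'a::comm_ring_1 set \<Rightarrow> ('a \<Rightarrow> 'a) set" where
  "cyc_aut K = {f. bij f \<and> (\<forall>S\<in>cyc_rels K. (\<lambda>(x, y). (f x, f y)) ` S = S)}"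

definition ring_aut :: "('a::comm_ring_1 \<Rightarrow> 'a) set" where
  "ring_aut = {\<sigma>. bij \<sigma> \<and> \<sigma> 1 = 1 \<and> (\<forall>x y. \<sigma> (x + y) = \<sigma> x + \<sigma> y)
     \<and> (\<forall>x y. \<sigma> (x * y) = \<sigma> x * \<sigma> y)}"

definition AGammaL1 :: "('a::comm_ring_1 \<Rightarrow> 'a) set" where
  "AGammaL1 = {f. \<exists>a b \<sigma>. a \<in> ring_units \<and> \<sigma> \<in> ring_aut \<and> f = (\<lambda>x. a * \<sigma> x + b)}"

definition cyc_normal :: "'a::comm_ring_1 set \<Rightarrow> bool" where
  "cyc_normal K \<longleftrightarrow> cyc_aut K \<subseteq> AGammaL1"

end

theory Submission
  imports Defs "HOL-Algebra.Multiplicative_Group" "HOL-Algebra.QuotRing"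
    "HOL-Computational_Algebra.Primes"
begin

text \<open>
  Write \<open>M\<close> for the radical, \<open>F = R / M\<close> and \<open>V = {m \<in> M. 1 + m \<in> K}\<close>; purity says that the
  additive group \<open>V\<close> contains no nonzero ideal. An automorphism \<open>f\<close> of the scheme, normalized by
  \<open>f 0 = 0\<close> and \<open>f 1 = 1\<close>, satisfies \<open>f x - f y \<in> (x - y) K\<close>. Comparing the points \<open>x\<close>, \<open>x + m\<close>
  and \<open>x - u\<close> for \<open>m \<in> M\<close> and a unit \<open>u\<close> gives
  \<open>(f (x + m) - f x) / (f x - f (x - u)) - m / u \<in> V\<close>. As \<open>M\<close> is not contained in \<open>V\<close>, the map
  \<open>b \<mapsto> 1 / (f x - f (x - 1 / b))\<close> is additive modulo \<open>M\<close> for every \<open>x\<close>; the cases \<open>x = 0\<close> and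
  \<open>x = 1\<close> force \<open>f\<close> to induce a field automorphism of \<open>F\<close>.

  The maps \<open>x \<mapsto> f (x + s) - f s\<close> and \<open>x \<mapsto> f (s x) / f s\<close> then differ from \<open>f\<close> by maps
  \<open>\<gamma> : F \<rightarrow> M\<close> (in the variable \<open>f x\<close>) all of whose slopes lie in \<open>V\<close>. Such a \<open>\<gamma>\<close> is affine:
  difference operators are nilpotent, which reduces to additive \<open>\<gamma>\<close>; there, with \<open>g\<close> a generator of
  the multiplicative group of \<open>F\<close> and \<open>T \<gamma> x = \<gamma> (g x) / g\<close>, the operator \<open>(1 - T) / (1 + g)\<close>
  preserves the slope condition, so the image of \<open>1 - T\<close> is an \<open>F\<close>-space and hence zero.
\<close>

subsection \<open>Local rings whose radical squares to zero\<close>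

text \<open>Locality enters as \<open>unit_iff\<close>, the vanishing square of the radical as
  \<open>mult_eq_0\<close>, and not being a field as \<open>ex_nonzero\<close>.\<close>

locale square_zero_local =
  fixes M :: "'a::comm_ring_1 set"
  assumes finite_ring: "finite (UNIV :: 'a set)"
    and zero_mem: "0 \<in> M"
    and add_mem: "x \<in> M \<Longrightarrow> y \<in> M \<Longrightarrow> x + y \<in> M"
    and mult_mem: "x \<in> M \<Longrightarrow> r * x \<in> M"
    and mult_eq_0: "x \<in> M \<Longrightarrow> y \<in> M \<Longrightarrow> x * y = 0"
    and unit_iff: "x dvd 1 \<longleftrightarrow> x \<notin> M"
    and ex_nonzero: "\<exists>x\<in>M. x \<noteq> 0"
begin

lemma mult_mem': "x \<in> M \<Longrightarrow> x * r \<in> M"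
  using mult_mem[of x r] by (simp add: mult.commute)

lemma uminus_mem: "x \<in> M \<Longrightarrow> - x \<in> M"
  using mult_mem[of x "-1"] by simp

lemma diff_mem: "x \<in> M \<Longrightarrow> y \<in> M \<Longrightarrow> x - y \<in> M"
  using add_mem[of x "- y"] uminus_mem[of y] by simp

lemmas mem_intros = zero_mem add_mem mult_mem mult_mem' uminus_mem diff_mem

lemma one_notin: "1 \<notin> M"
  using unit_iff[of 1] by simp

lemma mult_notin: "x \<notin> M \<Longrightarrow> y \<notin> M \<Longrightarrow> x * y \<notin> M"
  using unit_iff[of x] unit_iff[of y] unit_iff[of "x * y"] mult_dvd_mono[of x 1 y 1] by simp

lemma mult_mem_iff: "x * y \<in> M \<longleftrightarrow> x \<in> M \<or> y \<in> M"
  using mult_notin mult_mem mult_mem' by blast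

definition rinv :: "'a \<Rightarrow> 'a" where
  "rinv x = (SOME y. x * y = 1)"

lemma rinv_right: "x \<notin> M \<Longrightarrow> x * rinv x = 1"
  unfolding rinv_def by (rule someI_ex) (use unit_iff[of x] in \<open>auto elim!: dvdE intro: sym\<close>)

lemma rinv_left: "x \<notin> M \<Longrightarrow> rinv x * x = 1"
  using rinv_right[of x] by (simp add: mult.commute)

lemma rinv_notin: "x \<notin> M \<Longrightarrow> rinv x \<notin> M"
  using rinv_right[of x] mult_mem[of "rinv x" x] one_notin by auto

lemma rinv_unique: "x * y = 1 \<Longrightarrow> rinv x = y"
proof -
  assume xy: "x * y = 1"
  then have "x \<notin> M" using one_notin mult_mem' by metis
  then have "x * (rinv x - y) = 0" using xy by (simp add: right_diff_distrib rinv_right)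
  then have "y * (x * (rinv x - y)) = 0" by simp
  then show "rinv x = y" using xy by (simp add: mult.assoc[symmetric] mult.commute[of y x])
qed

lemma rinv_rinv: "x \<notin> M \<Longrightarrow> rinv (rinv x) = x"
  by (rule rinv_unique) (rule rinv_left)

text \<open>The least positive \<open>n\<close> with \<open>of_nat n\<close> in \<open>M\<close> is
  prime, since a product of two elements outside \<open>M\<close> stays outside.\<close>

lemma ex_char_prime: "\<exists>p. prime p \<and> of_nat p \<in> M"
proof -
  define p where "p = (LEAST n. 0 < n \<and> of_nat n \<in> M)"
  have "0 < CHAR('a) \<and> of_nat CHAR('a) \<in> M"
    using finite_imp_CHAR_pos[OF finite_ring] zero_mem by simp
  then have p: "0 < p \<and> of_nat p \<in> M"
    unfolding p_def by (rule LeastI)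
  have least: "n < p \<Longrightarrow> 0 < n \<Longrightarrow> of_nat n \<notin> M" for n
    unfolding p_def using not_less_Least by blast
  have "p \<noteq> 1" using p one_notin by auto
  moreover have "m = 1 \<or> m = p" if dvd: "m dvd p" for m
  proof (rule ccontr)
    assume *: "\<not> (m = 1 \<or> m = p)"
    obtain k where k: "p = m * k" using dvd by (rule dvdE)
    have "0 < m" "0 < k" using p k by auto
    moreover have "m < p" using * dvd p dvd_imp_le[of m p] by auto
    moreover have "k < p" using * k \<open>0 < m\<close> \<open>0 < k\<close> by (cases m) auto
    ultimately have "of_nat m \<notin> M" "of_nat k \<notin> M" using least by auto
    then show False using mult_notin p k by auto
  qed
  ultimately have "prime p" using p by (auto simp: prime_nat_iff)
  then show ?thesis using p by blast
qed

text \<open>The multiplicative group of the finite field \<open>R / M\<close> is cyclic, and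
  \<open>n + 1\<close> is the size of that field. Congruences keep the quotient ring out of later
  arguments.\<close>

lemma ex_residue_primitive_root:
  "\<exists>g n. g \<notin> M \<and> (\<forall>u. u \<notin> M \<longrightarrow> (\<exists>k. u - g ^ k \<in> M)) \<and> g ^ n - 1 \<in> M \<and> of_nat n + 1 \<in> M"
proof -
  define R :: "'a ring" where
    "R = \<lparr>carrier = UNIV, monoid.mult = (*), one = 1, zero = 0, add = (+)\<rparr>"
  have "cring R"
    by (rule cringI[OF abelian_groupI comm_monoidI])
       (auto simp: R_def algebra_simps intro: exI[of _ "- x" for x])
  then interpret R: cring R .
  have minusR: "a_inv R x = - x" for x
    using R.minus_equality[of "- x" x] by (simp add: R_def)
  have ideal_M: "ideal M R"
  proof (rule idealI[OF R.ring_axioms R.add.subgroupI])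
    show "a_inv R a \<in> M" if "a \<in> M" for a
      using that by (simp add: minusR uminus_mem)
  qed (use mem_intros in \<open>auto simp: R_def\<close>)
  have "maximalideal M R"
  proof (rule maximalidealI[OF ideal_M])
    show "carrier R \<noteq> M" using one_notin by (auto simp: R_def)
  next
    fix J assume J: "ideal J R" "M \<subseteq> J"
    show "J = M \<or> J = carrier R"
    proof (cases "J = M")
      case False
      then obtain u where u: "u \<in> J" "u \<notin> M" using J by blast
      have "x \<in> J" for x
      proof -
        have "(x * rinv u) * u \<in> J"
          using ideal.I_l_closed[OF J(1) u(1), of "x * rinv u"] by (simp add: R_def)
        then show ?thesis using rinv_left[OF u(2)] by (simp add: mult.assoc)
      qed
      then show ?thesis by (auto simp: R_def)
    qed simp
  qed
  then interpret M: maximalideal M R .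
  define Q where "Q = R Quot M"
  have "field Q" unfolding Q_def by (rule M.quotient_is_field[OF R.cring_axioms])
  then interpret Q: field Q .
  define h where "h = (\<lambda>x. a_r_coset R M x)"
  interpret h: ring_hom_cring R Q h
    unfolding h_def Q_def by (rule M.rcos_ring_hom_cring[OF R.cring_axioms])
  have h_eq: "h x = h y \<longleftrightarrow> x - y \<in> M" for x y
    using R.quotient_eq_iff_same_a_r_cos[OF ideal_M, of x y]
    using minusR by (simp add: h_def R_def a_minus_def)
  have carrier_Q: "carrier Q = range h"
    by (auto simp: Q_def FactRing_def h_def A_RCOSETS_def' R_def)
  have h_pow: "h (x ^ k) = h x [^]\<^bsub>Q\<^esub> k" for x k
    by (induction k) (use h.hom_mult h.hom_one in \<open>simp_all add: R_def power_Suc2 del: power_Suc\<close>)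
  have h_0_iff: "h x = \<zero>\<^bsub>Q\<^esub> \<longleftrightarrow> x \<in> M" for x
    using h_eq[of x 0] h.hom_zero by (simp add: R_def)
  have h_nat: "h (of_nat k) = add_pow Q k \<one>\<^bsub>Q\<^esub>" for k :: nat
  proof (induction k)
    case 0
    then show ?case using h.hom_zero by (simp add: R_def)
  next
    case (Suc k)
    then show ?case using h.hom_add[of "of_nat k" 1] h.hom_one
      by (simp add: R_def add.commute)
  qed
  have finQ: "finite (carrier Q)" using carrier_Q finite_ring by simp
  obtain a where a: "a \<in> carrier (mult_of Q)"
    and gen: "carrier (mult_of Q) = {a [^]\<^bsub>Q\<^esub> i | i :: nat. i \<in> UNIV}"
    using Q.finite_field_mult_group_has_gen[OF finQ] by blast
  obtain g where g: "a = h g" using a carrier_Q by auto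
  then have g_notin: "g \<notin> M" using a h_0_iff[of g] by (simp del: set_eq_iff)
  define n where "n = order (mult_of Q)"
  have "a [^]\<^bsub>Q\<^esub> n = \<one>\<^bsub>Q\<^esub>"
    using group.pow_order_eq_1[OF Q.field_mult_group a] by (simp add: n_def nat_pow_mult_of)
  then have 1: "g ^ n - 1 \<in> M"
    using h_eq[of "g ^ n" 1] h.hom_one by (simp add: h_pow g R_def)
  have "order Q = n + 1"
    using Q.order_mult_of[OF finQ] Q.order_gt_0_iff_finite finQ by (simp add: n_def)
  moreover have "add_pow Q (order Q) \<one>\<^bsub>Q\<^esub> = \<zero>\<^bsub>Q\<^esub>"
    using group.pow_order_eq_1[OF Q.add.is_group, of "\<one>\<^bsub>Q\<^esub>"]
    by (simp add: add_pow_def order_def)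
  ultimately have 2: "of_nat n + 1 \<in> M"
    using h_nat[of "n + 1"] h_0_iff[of "of_nat n + 1"] by (simp add: add.commute)
  have "\<exists>k. u - g ^ k \<in> M" if "u \<notin> M" for u
  proof -
    have "h u \<in> carrier (mult_of Q)" using that carrier_Q h_0_iff by auto
    then obtain k :: nat where "h u = a [^]\<^bsub>Q\<^esub> k" using gen by auto
    then show ?thesis using h_eq g h_pow by metis
  qed
  then show ?thesis using g_notin 1 2 by blast
qed

end

subsection \<open>Functions with slopes in a pure subgroup\<close>

text \<open>Exact equations will be proved through \<open>V_pure\<close>, by showing that all
  multiples of a difference lie in \<open>V\<close>.\<close>

locale pure_subgroup = square_zero_local M for M :: "'a::comm_ring_1 set" +
  fixes V :: "'a set"
  assumes V_sub: "V \<subseteq> M"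
    and V_zero: "0 \<in> V"
    and V_diff: "v \<in> V \<Longrightarrow> w \<in> V \<Longrightarrow> v - w \<in> V"
    and V_pure: "(\<And>r. r * m \<in> V) \<Longrightarrow> m = 0"
begin

section \<open>Additive maps with slopes in \<open>V\<close>\<close>

lemma V_mem: "v \<in> V \<Longrightarrow> v \<in> M"
  using V_sub by blast

definition additive_slopes :: "('a \<Rightarrow> 'a) set" where
  "additive_slopes = {\<gamma>. (\<forall>x y. \<gamma> (x + y) = \<gamma> x + \<gamma> y) \<and> (\<forall>x. \<exists>v\<in>V. \<gamma> x = x * v)}"

lemma
  assumes "\<gamma> \<in> additive_slopes"
  shows additive_slopes_add: "\<gamma> (x + y) = \<gamma> x + \<gamma> y"
    and additive_slopes_ex: "\<exists>v\<in>V. \<gamma> x = x * v"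
    and additive_slopes_mem: "\<gamma> x \<in> M"
    and additive_slopes_eq_0: "x \<in> M \<Longrightarrow> \<gamma> x = 0"
    and additive_slopes_diff: "\<gamma> (x - y) = \<gamma> x - \<gamma> y"
proof -
  show add: "\<gamma> (x + y) = \<gamma> x + \<gamma> y" for x y
    using assms by (simp add: additive_slopes_def)
  show ex: "\<exists>v\<in>V. \<gamma> x = x * v" for x
    using assms by (simp add: additive_slopes_def)
  show "\<gamma> x \<in> M" using ex[of x] V_mem mult_mem by auto
  show "\<gamma> x = 0" if "x \<in> M" using ex[of x] V_mem that mult_eq_0 by auto
  show "\<gamma> (x - y) = \<gamma> x - \<gamma> y" using add[of "x - y" y] by simp
qed

lemma finite_additive_slopes: "finite additive_slopes"
proof -
  have "finite (UNIV :: ('a \<Rightarrow> 'a) set)"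
    using finite_set_of_finite_funs[OF finite_ring finite_ring] by simp
  then show ?thesis by (rule rev_finite_subset) simp
qed

lemma fun_diff_additive_slopes:
  assumes "\<gamma> \<in> additive_slopes" "\<delta> \<in> additive_slopes"
  shows "(\<lambda>x. \<gamma> x - \<delta> x) \<in> additive_slopes"
proof -
  have "\<exists>v\<in>V. \<gamma> x - \<delta> x = x * v" for x
    using additive_slopes_ex[OF assms(1), of x] additive_slopes_ex[OF assms(2), of x]
    by (metis V_diff right_diff_distrib)
  then show ?thesis using assms by (auto simp: additive_slopes_def)
qed

text \<open>At a unit \<open>x\<close>, the map \<open>\<gamma>\<close> multiplied by
  \<open>x * r\<close> has slope \<open>r * \<gamma> x\<close>, so purity applies to
  \<open>\<gamma> x\<close>.\<close>

lemma scalar_closed_eq_0: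
  assumes "\<And>c. (\<lambda>x. c * \<gamma> x) \<in> additive_slopes"
  shows "\<gamma> x = 0"
proof -
  have \<gamma>: "\<gamma> \<in> additive_slopes" using assms[of 1] by simp
  show ?thesis
  proof (cases "x \<in> M")
    case False
    have "r * \<gamma> x \<in> V" for r
    proof -
      obtain v where "v \<in> V" "x * r * \<gamma> x = x * v"
        using additive_slopes_ex[OF assms[of "x * r"], of x] by auto
      then have "rinv x * x * (r * \<gamma> x) = rinv x * x * v" by (simp add: mult.assoc)
      then show ?thesis using \<open>v \<in> V\<close> by (simp add: rinv_left[OF False])
    qed
    then show ?thesis by (rule V_pure)
  qed (rule additive_slopes_eq_0[OF \<gamma>])
qed

text \<open>Once \<open>D \<gamma> = 0\<close>, \<open>\<gamma>\<close> commutes with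
  \<open>g\<close>, whose powers represent all units modulo \<open>M\<close>. Unless
  \<open>1 + g\<close> is in \<open>M\<close>, this follows because the image \<open>U\<close> of
  \<open>D\<close> is stable under all scalars.\<close>

lemma additive_slopes_linear:
  assumes \<gamma>: "\<gamma> \<in> additive_slopes"
  shows "\<gamma> x = x * \<gamma> 1"
proof -
  obtain g n where g: "g \<notin> M" and gen: "\<And>u. u \<notin> M \<Longrightarrow> \<exists>k. u - g ^ k \<in> M"
    and gn: "g ^ n - 1 \<in> M" and n: "of_nat n + 1 \<in> M"
    using ex_residue_primitive_root by blast
  define D :: "('a \<Rightarrow> 'a) \<Rightarrow> 'a \<Rightarrow> 'a" where "D = (\<lambda>\<gamma> x. \<gamma> x - rinv g * \<gamma> (g * x))"
  define U where "U = D ` additive_slopes"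
  have D_diff: "D (\<lambda>x. \<gamma> x - \<delta> x) = (\<lambda>x. D \<gamma> x - D \<delta> x)" for \<gamma> \<delta>
    by (simp add: D_def fun_eq_iff algebra_simps)
  have D_scale: "D (\<lambda>x. c * \<gamma> x) = (\<lambda>x. c * D \<gamma> x)" for c \<gamma>
    by (simp add: D_def fun_eq_iff algebra_simps)
  have D_slopes: "D \<delta> \<in> additive_slopes" if \<delta>: "\<delta> \<in> additive_slopes" for \<delta>
  proof -
    have "\<exists>v\<in>V. rinv g * \<delta> (g * x) = x * v" for x
    proof -
      obtain v where "v \<in> V" "\<delta> (g * x) = g * x * v"
        using additive_slopes_ex[OF \<delta>] by blast
      then show ?thesis by (metis rinv_left[OF g] mult.assoc mult_1)
    qed
    then have "(\<lambda>x. rinv g * \<delta> (g * x)) \<in> additive_slopes"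
      using \<delta> by (auto simp: additive_slopes_def distrib_left)
    then show ?thesis
      unfolding D_def by (rule fun_diff_additive_slopes[OF \<delta>])
  qed
  have fixed: "\<delta> (g ^ k * x) = g ^ k * \<delta> x" if "D \<delta> = (\<lambda>_. 0)" for \<delta> k x
  proof -
    have step: "\<delta> (g * x) = g * \<delta> x" for x
    proof -
      have "rinv g * \<delta> (g * x) = \<delta> x" using fun_cong[OF that, of x] by (simp add: D_def)
      then have "g * rinv g * \<delta> (g * x) = g * \<delta> x" by (simp only: mult.assoc)
      then show ?thesis by (simp only: rinv_right[OF g] mult_1)
    qed
    show ?thesis
    proof (induction k)
      case (Suc k)
      have "\<delta> (g ^ Suc k * x) = g * \<delta> (g ^ k * x)"
        using step[of "g ^ k * x"] by (simp add: mult.assoc)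
      then show ?case using Suc by (simp add: mult.assoc)
    qed simp
  qed
  have U_slopes: "U \<subseteq> additive_slopes" using D_slopes by (auto simp: U_def)
  have U_diff: "(\<lambda>x. u x - v x) \<in> U" if uv: "u \<in> U" "v \<in> U" for u v
  proof -
    obtain a b where "a \<in> additive_slopes" "b \<in> additive_slopes" "u = D a" "v = D b"
      using uv by (auto simp: U_def)
    then show ?thesis
      using imageI[OF fun_diff_additive_slopes[of a b], of D] by (simp add: U_def D_diff)
  qed
  \<comment> \<open>The order \<open>n\<close> of \<open>g\<close> modulo \<open>M\<close> acts on \<open>M\<close> as \<open>- 1\<close>, so a unipotent action of \<open>g\<close> is trivial.\<close>
  have U_fixed: "u = (\<lambda>_. 0)" if u: "u \<in> U" and Du: "D u = (\<lambda>_. 0)" for u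
  proof
    fix x
    obtain w where w: "w \<in> additive_slopes" "u = D w" using u by (auto simp: U_def)
    have step: "w (g * y) = g * (w y - u y)" for y
      by (simp add: w(2) D_def mult.assoc[symmetric] rinv_right[OF g])
    \<comment> \<open>With \<open>T = 1 - D\<close>, \<open>T w = w - u\<close> and
      \<open>T u = u\<close>, so the \<open>k\<close>-th power of \<open>T\<close> sends
      \<open>w\<close> to \<open>w - k u\<close>.\<close>
    have iter: "w (g ^ k * x) = g ^ k * (w x - of_nat k * u x)" for k
    proof (induction k)
      case (Suc k)
      have "w (g ^ Suc k * x) = g * (w (g ^ k * x) - u (g ^ k * x))"
        using step[of "g ^ k * x"] by (simp add: mult.assoc)
      also have "\<dots> = g * (g ^ k * (w x - of_nat k * u x) - g ^ k * u x)"
        unfolding Suc fixed[OF Du, of k x] ..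
      also have "\<dots> = g ^ Suc k * (w x - of_nat (Suc k) * u x)" by (simp add: algebra_simps)
      finally show ?case .
    qed simp
    have act: "g ^ n * m = m" if "m \<in> M" for m
      using mult_eq_0[OF gn that] by (simp add: algebra_simps)
    have "w ((g ^ n - 1) * x) = 0"
      using additive_slopes_eq_0[OF w(1)] mult_mem'[OF gn] by blast
    then have "w (g ^ n * x) = w x"
      using additive_slopes_diff[OF w(1), of "g ^ n * x" x] by (simp add: left_diff_distrib)
    moreover have uM: "u x \<in> M" and "w x \<in> M"
      using u U_slopes additive_slopes_mem w(1) by auto
    ultimately have "of_nat n * u x = 0"
      using iter[of n] act[of "w x - of_nat n * u x"] by (simp add: mem_intros)
    then show "u x = 0" using mult_eq_0[OF n uM] by (simp add: distrib_right)
  qed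
  have D_0: "D \<gamma> = (\<lambda>_. 0)"
  proof (cases "1 + g \<in> M")
    \<comment> \<open>Here \<open>g\<close> acts as \<open>- 1\<close> on the residue field and on
      \<open>M\<close>, and additive maps commute with negation.\<close>
    case True
    have "rinv g * \<gamma> (g * x) = \<gamma> x" for x
    proof -
      have "\<gamma> ((1 + g) * x) = 0" using additive_slopes_eq_0[OF \<gamma>] mult_mem'[OF True] by blast
      then have 1: "\<gamma> x + \<gamma> (g * x) = 0"
        using additive_slopes_add[OF \<gamma>, of x "g * x"] by (simp add: distrib_right)
      have "(1 + g) * \<gamma> x = 0" using mult_eq_0[OF True] additive_slopes_mem[OF \<gamma>] by blast
      then have "\<gamma> x + g * \<gamma> x = \<gamma> x + \<gamma> (g * x)"
        using 1 by (simp add: distrib_right)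
      then have "\<gamma> (g * x) = g * \<gamma> x" by simp
      then have "rinv g * \<gamma> (g * x) = rinv g * g * \<gamma> x" by (simp only: mult.assoc)
      then show ?thesis by (simp only: rinv_left[OF g] mult_1)
    qed
    then show ?thesis by (simp add: D_def)
  next
    case False
    define c where "c = rinv (1 + g)"
    have cs: "c * (1 + g) = 1" by (simp add: c_def rinv_left[OF False])
    have cs': "(1 + g) * c = 1" by (simp add: c_def rinv_right[OF False])
    \<comment> \<open>Writing \<open>\<delta> x\<close> as
      \<open>\<delta> (x + g * x) - \<delta> (g * x)\<close> expresses \<open>D \<delta> x\<close>
      through the slopes \<open>v1\<close> and \<open>v2\<close>, with the common factor
      \<open>1 + g\<close>.\<close>
    have A: "(\<lambda>x. c * D \<delta> x) \<in> additive_slopes" if \<delta>: "\<delta> \<in> additive_slopes" for \<delta>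
    proof -
      have "\<exists>v\<in>V. c * D \<delta> x = x * v" for x
      proof -
        obtain v1 where v1: "v1 \<in> V" "\<delta> (x + g * x) = (x + g * x) * v1"
          using additive_slopes_ex[OF \<delta>] by blast
        obtain v2 where v2: "v2 \<in> V" "\<delta> (g * x) = g * x * v2"
          using additive_slopes_ex[OF \<delta>] by blast
        have "\<delta> x = \<delta> (x + g * x) - \<delta> (g * x)"
          using additive_slopes_add[OF \<delta>, of x "g * x"] by simp
        then have "\<delta> x = (x + g * x) * v1 - g * x * v2" unfolding v1(2) v2(2) .
        moreover have "rinv g * \<delta> (g * x) = rinv g * g * x * v2"
          unfolding v2(2) by (simp only: mult.assoc)
        ultimately have "D \<delta> x = (x + g * x) * v1 - g * x * v2 - x * v2"
          by (simp add: D_def rinv_left[OF g])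
        also have "\<dots> = (1 + g) * (x * (v1 - v2))" by (simp add: algebra_simps)
        finally have "c * D \<delta> x = c * (1 + g) * (x * (v1 - v2))"
          by (simp only: mult.assoc)
        then have "c * D \<delta> x = x * (v1 - v2)" by (simp add: cs)
        then show ?thesis using V_diff v1 v2 by blast
      qed
      then show ?thesis
        using D_slopes[OF \<delta>] by (auto simp: additive_slopes_def distrib_left)
    qed
    have finU: "finite U" using finite_additive_slopes by (simp add: U_def)
    have "inj_on D U"
    proof (rule inj_onI)
      fix u v assume uv: "u \<in> U" "v \<in> U" "D u = D v"
      have "D (\<lambda>x. u x - v x) = (\<lambda>_. 0)" unfolding D_diff uv(3) by simp
      then have "(\<lambda>x. u x - v x) = (\<lambda>_. 0)" by (rule U_fixed[OF U_diff[OF uv(1,2)]])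
      then have "u x - v x = 0" for x by (rule fun_cong)
      then show "u = v" by (simp add: fun_eq_iff)
    qed
    moreover have "D ` U \<subseteq> U"
      using image_mono[OF U_slopes, of D] by (simp add: U_def)
    ultimately have DU: "D ` U = U" by (intro endo_inj_surj finU)
    \<comment> \<open>As \<open>D\<close> permutes \<open>U\<close>, \<open>u = D (D w)\<close>;
      then \<open>c * u = D (c * D w)\<close>, where \<open>c * D w\<close> has slopes in
      \<open>V\<close> by \<open>A\<close>.\<close>
    have "(\<lambda>x. c * u x) \<in> U" if u: "u \<in> U" for u
    proof -
      obtain w where w: "w \<in> additive_slopes" "u = D (D w)"
        using u DU by (auto simp: U_def)
      then show ?thesis using imageI[OF A[OF w(1)], of D] by (simp add: U_def D_scale)
    qed
    then have "(\<lambda>u x. c * u x) ` U \<subseteq> U" by blast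
    moreover have "inj_on (\<lambda>u x. c * u x) U"
    proof (rule inj_onI)
      fix u v :: "'a \<Rightarrow> 'a" assume *: "(\<lambda>x. c * u x) = (\<lambda>x. c * v x)"
      show "u = v"
      proof
        fix x
        have "(1 + g) * (c * u x) = (1 + g) * (c * v x)" using fun_cong[OF *, of x] by simp
        then show "u x = v x" unfolding mult.assoc[symmetric] cs' by simp
      qed
    qed
    ultimately have cU: "(\<lambda>u x. c * u x) ` U = U"
      by (rule endo_inj_surj[OF finU])
    \<comment> \<open>Multiplication by \<open>c\<close> permutes the finite set \<open>U\<close>,
      hence so does its inverse \<open>1 + g\<close>; subtracting the identity leaves
      \<open>g\<close>.\<close>
    have gU: "(\<lambda>x. g * u x) \<in> U" if u: "u \<in> U" for u
    proof -
      have "u \<in> (\<lambda>u x. c * u x) ` U" using u cU by simp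
      then obtain w where w: "u = (\<lambda>x. c * w x)" "w \<in> U" by (rule imageE)
      have "(1 + g) * u x = w x" for x
        unfolding w(1) mult.assoc[symmetric] cs' by simp
      then have "(\<lambda>x. g * u x) = (\<lambda>x. w x - u x)"
        by (simp add: fun_eq_iff distrib_right eq_diff_eq add.commute)
      then show ?thesis using U_diff[OF w(2) u] by simp
    qed
    have gkU: "(\<lambda>x. g ^ k * u x) \<in> U" if u: "u \<in> U" for u k
    proof (induction k)
      case (Suc k)
      show ?case using gU[OF Suc.IH] by (simp add: mult.assoc)
    qed (simp add: u)
    have "(\<lambda>x. r * u x) \<in> additive_slopes" if u: "u \<in> U" for u r
    proof -
      have uM: "u x \<in> M" for x using u U_slopes additive_slopes_mem by blast
      show ?thesis
      proof (cases "r \<in> M")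
        case True
        then have "(\<lambda>x. r * u x) = (\<lambda>x. u x - u x)" using mult_eq_0 uM by simp
        then show ?thesis using U_diff[OF u u] U_slopes by auto
      next
        case False
        then obtain k where k: "r - g ^ k \<in> M" using gen by blast
        have "r * u x = g ^ k * u x" for x
          using mult_eq_0[OF k uM[of x]] by (simp add: left_diff_distrib)
        then show ?thesis using gkU[OF u, of k] U_slopes by auto
      qed
    qed
    then have "D \<gamma> x = 0" for x
      using \<gamma> by (intro scalar_closed_eq_0) (auto simp: U_def)
    then show ?thesis by blast
  qed
  show ?thesis
  proof (cases "x \<in> M")
    case True
    then show ?thesis
      using additive_slopes_eq_0[OF \<gamma>] additive_slopes_mem[OF \<gamma>] mult_eq_0 by simp
  next
    case False
    then obtain k where k: "x - g ^ k \<in> M" using gen by blast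
    have "\<gamma> x - \<gamma> (g ^ k) = 0"
      using additive_slopes_eq_0[OF \<gamma> k] additive_slopes_diff[OF \<gamma>] by simp
    moreover have "\<gamma> (g ^ k) = g ^ k * \<gamma> 1" using fixed[OF D_0, of k 1] by simp
    moreover have "(x - g ^ k) * \<gamma> 1 = 0"
      using mult_eq_0[OF k] additive_slopes_mem[OF \<gamma>] by blast
    ultimately show ?thesis by (simp add: left_diff_distrib)
  qed
qed

end

section \<open>Finite differences\<close>

definition shift_diff :: "'a::comm_ring_1 \<Rightarrow> ('a \<Rightarrow> 'a) \<Rightarrow> 'a \<Rightarrow> 'a" where
  "shift_diff b \<gamma> = (\<lambda>x. \<gamma> (x + b) - \<gamma> x)"

lemma shift_diff_commute: "shift_diff a (shift_diff b \<gamma>) = shift_diff b (shift_diff a \<gamma>)"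
  by (simp add: shift_diff_def fun_eq_iff algebra_simps)

lemma shift_diff_funpow_commute:
  "shift_diff a ((shift_diff b ^^ n) \<gamma>) = (shift_diff b ^^ n) (shift_diff a \<gamma>)"
  by (induction n) (simp_all add: shift_diff_commute[of a b])

text \<open>The shift by \<open>b\<close> is \<open>1 + shift_diff b\<close>; this is the binomial
  expansion of its \<open>n\<close>-th power.\<close>

lemma newton_forward_difference:
  "\<gamma> (x + of_nat n * b) = (\<Sum>k\<le>n. of_nat (n choose k) * (shift_diff b ^^ k) \<gamma> x)"
proof (induction n arbitrary: x)
  case (Suc n)
  let ?D = "\<lambda>k. (shift_diff b ^^ k) \<gamma>"
  have D: "?D k (x + b) = ?D k x + ?D (Suc k) x" for k
    by (simp add: shift_diff_def)
  \<comment> \<open>The case expression is \<open>n choose (k - 1)\<close> with value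
    \<open>0\<close> at \<open>k = 0\<close>, as Pascal's rule requires.\<close>
  have shift: "(\<Sum>k\<le>n. of_nat (n choose k) * ?D (Suc k) x)
      = (\<Sum>k\<le>Suc n. of_nat (case k of 0 \<Rightarrow> 0 | Suc j \<Rightarrow> n choose j) * ?D k x)"
    by (subst sum.atMost_Suc_shift) (simp del: funpow.simps)
  have "\<gamma> (x + of_nat (Suc n) * b) = (\<Sum>k\<le>n. of_nat (n choose k) * ?D k (x + b))"
    using Suc[of "x + b"] by (simp add: algebra_simps)
  also have "\<dots> = (\<Sum>k\<le>Suc n. of_nat (n choose k) * ?D k x)
      + (\<Sum>k\<le>n. of_nat (n choose k) * ?D (Suc k) x)"
    by (simp add: D distrib_left sum.distrib binomial_eq_0 del: funpow.simps)
  also have "\<dots> = (\<Sum>k\<le>Suc n. of_nat (Suc n choose k) * ?D k x)"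
    unfolding shift sum.distrib[symmetric]
    by (intro sum.cong refl) (auto simp: distrib_right binomial_eq_0 split: nat.split simp del: funpow.simps)
  finally show ?case .
qed simp

section \<open>Arbitrary maps with slopes in \<open>V\<close>\<close>

context pure_subgroup
begin

definition slopes :: "('a \<Rightarrow> 'a) set" where
  "slopes = {\<gamma>. (\<forall>x. \<gamma> x \<in> M) \<and> (\<forall>x y. \<exists>v\<in>V. \<gamma> x - \<gamma> y = (x - y) * v)}"

text \<open>The constant ranges over \<open>M\<close>: differences of \<open>x * v\<close> are
  constants \<open>b * v\<close>, which need not lie in \<open>V\<close>.\<close>

definition affine_slopes :: "('a \<Rightarrow> 'a) set" where
  "affine_slopes = {\<gamma>. \<exists>c\<in>M. \<exists>v\<in>V. \<gamma> = (\<lambda>x. c + x * v)}"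

lemma slopes_ex: "\<gamma> \<in> slopes \<Longrightarrow> \<exists>v\<in>V. \<gamma> x - \<gamma> y = (x - y) * v"
  by (simp add: slopes_def)

lemma slopes_cong:
  assumes "\<gamma> \<in> slopes" "x - y \<in> M"
  shows "\<gamma> x = \<gamma> y"
  using slopes_ex[OF assms(1), of x y] mult_eq_0[OF assms(2)] V_mem by auto

lemma shift_diff_slopes:
  assumes "\<gamma> \<in> slopes"
  shows "shift_diff b \<gamma> \<in> slopes"
proof -
  have "\<exists>v\<in>V. shift_diff b \<gamma> x - shift_diff b \<gamma> y = (x - y) * v" for x y
  proof -
    obtain v where v: "v \<in> V" "\<gamma> (x + b) - \<gamma> (y + b) = (x + b - (y + b)) * v"
      using slopes_ex[OF assms] by blast
    obtain w where w: "w \<in> V" "\<gamma> x - \<gamma> y = (x - y) * w"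
      using slopes_ex[OF assms] by blast
    have "shift_diff b \<gamma> x - shift_diff b \<gamma> y = (\<gamma> (x + b) - \<gamma> (y + b)) - (\<gamma> x - \<gamma> y)"
      by (simp add: shift_diff_def)
    also have "\<dots> = (x - y) * (v - w)" unfolding v(2) w(2) by (simp add: algebra_simps)
    finally show ?thesis using V_diff v w by blast
  qed
  then show ?thesis using assms by (auto simp: slopes_def shift_diff_def diff_mem)
qed

lemma shift_diff_affine_slopes:
  assumes "\<gamma> \<in> affine_slopes"
  shows "shift_diff b \<gamma> \<in> affine_slopes"
proof -
  obtain c v where "v \<in> V" "\<gamma> = (\<lambda>x. c + x * v)" using assms by (auto simp: affine_slopes_def)
  then have "shift_diff b \<gamma> = (\<lambda>x. b * v + x * 0)"
    by (simp add: shift_diff_def algebra_simps)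
  moreover have "b * v \<in> M" using \<open>v \<in> V\<close> V_mem mult_mem by blast
  ultimately show ?thesis unfolding affine_slopes_def using V_zero by blast
qed

text \<open>For a prime \<open>p\<close> in \<open>M\<close> the inner binomial coefficients
  annihilate \<open>M\<close>, so shifting by \<open>p * b\<close> adds the \<open>p\<close>-th
  difference; but this shift fixes \<open>\<gamma>\<close>.\<close>

lemma shift_diff_nilpotent:
  assumes "\<gamma> \<in> slopes"
  shows "\<exists>n. (shift_diff b ^^ n) \<gamma> = (\<lambda>_. 0)"
proof -
  obtain p where p: "Factorial_Ring.prime p" "of_nat p \<in> M" using ex_char_prime by blast
  have mem: "(shift_diff b ^^ k) \<gamma> x \<in> M" for k x
  proof -
    have "(shift_diff b ^^ k) \<gamma> \<in> slopes"
      by (induction k) (simp_all add: assms shift_diff_slopes)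
    then show ?thesis by (simp add: slopes_def)
  qed
  have "(shift_diff b ^^ p) \<gamma> x = 0" for x
  proof -
    let ?t = "\<lambda>k. of_nat (p choose k) * (shift_diff b ^^ k) \<gamma> x"
    have "?t k = 0" if k: "k \<in> {..p} - {0, p}" for k
    proof -
      have "p dvd p choose k" using p k by (intro dvd_choose_prime) auto
      then obtain j where "p choose k = p * j" ..
      then have "of_nat (p choose k) \<in> M" using p mult_mem' by simp
      then show ?thesis using mult_eq_0 mem by blast
    qed
    then have "(\<Sum>k\<le>p. ?t k) = (\<Sum>k\<in>{0, p}. ?t k)"
      by (intro sum.mono_neutral_right) auto
    also have "\<dots> = \<gamma> x + (shift_diff b ^^ p) \<gamma> x"
      using p(1) prime_gt_0_nat[of p] by simp
    finally have "\<gamma> (x + of_nat p * b) = \<gamma> x + (shift_diff b ^^ p) \<gamma> x"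
      by (simp add: newton_forward_difference)
    moreover have "\<gamma> (x + of_nat p * b) = \<gamma> x"
      using p mult_mem' by (intro slopes_cong assms) simp
    ultimately show ?thesis by simp
  qed
  then show ?thesis by blast
qed

text \<open>Symmetry of \<open>\<gamma> (x + b)\<close> yields \<open>x * v b = b * v x\<close> for
  the linear coefficients. So \<open>b * v 1 = v b\<close> is in \<open>V\<close> for all
  \<open>b\<close>, purity gives \<open>v = 0\<close>, and \<open>\<gamma> - \<gamma> 0\<close> is
  additive.\<close>

lemma slopes_affine_if_shift_diff_affine:
  assumes \<gamma>: "\<gamma> \<in> slopes" and aff: "\<And>b. shift_diff b \<gamma> \<in> affine_slopes"
  shows "\<gamma> \<in> affine_slopes"
proof -
  define \<delta> where "\<delta> = (\<lambda>x. \<gamma> x - \<gamma> 0)"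
  have "\<exists>c v. v \<in> V \<and> (\<forall>x. \<gamma> (x + b) - \<gamma> x = c + x * v)" for b
    using aff[of b] by (auto simp: affine_slopes_def shift_diff_def fun_eq_iff)
  then obtain c v where v: "\<And>b. v b \<in> V" and c: "\<And>b x. \<gamma> (x + b) - \<gamma> x = c b + x * v b"
    by metis
  have step: "\<delta> (x + b) = \<delta> x + \<delta> b + x * v b" for x b
  proof -
    have "\<delta> (x + b) = \<delta> x + (\<gamma> (x + b) - \<gamma> x)" by (simp add: \<delta>_def)
    also have "\<dots> = \<delta> x + (c b + x * v b)" by (simp only: c)
    also have "c b = \<delta> b" using c[where x = 0 and b = b] by (simp add: \<delta>_def)
    finally show ?thesis by (simp add: add.assoc)
  qed
  have sym: "x * v b = b * v x" for x b
  proof -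
    have "\<delta> x + \<delta> b + x * v b = \<delta> x + \<delta> b + b * v x"
      using step[of x b] step[of b x] by (simp only: add.commute)
    then show ?thesis by simp
  qed
  have "b * v 1 \<in> V" for b using sym[of 1 b] v[of b] by simp
  then have "v 1 = 0" by (rule V_pure)
  then have "v b = 0" for b using sym[of 1 b] by simp
  then have "\<delta> (x + b) = \<delta> x + \<delta> b" for x b using step by simp
  moreover have ex: "\<exists>v\<in>V. \<delta> x = x * v" for x
    using slopes_ex[OF \<gamma>, of x 0] by (simp add: \<delta>_def)
  ultimately have "\<delta> \<in> additive_slopes" by (simp add: additive_slopes_def)
  then have "\<delta> x = x * \<delta> 1" for x by (rule additive_slopes_linear)
  then have "\<gamma> = (\<lambda>x. \<gamma> 0 + x * \<delta> 1)" by (simp add: \<delta>_def fun_eq_iff algebra_simps)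
  moreover have "\<gamma> 0 \<in> M" using \<gamma> by (simp add: slopes_def)
  moreover have "\<delta> 1 \<in> V" using ex[of 1] by simp
  ultimately show ?thesis unfolding affine_slopes_def by blast
qed

text \<open>
  The difference operators are nilpotent and commute, so a non-affine element of \<open>slopes\<close> can be
  replaced by one all of whose differences are affine.
\<close>

lemma slopes_affine:
  assumes "\<gamma> \<in> slopes"
  shows "\<gamma> \<in> affine_slopes"
proof (rule ccontr)
  assume "\<gamma> \<notin> affine_slopes"
  have zero: "(\<lambda>_. 0) \<in> affine_slopes"
    unfolding affine_slopes_def using V_zero zero_mem by force
  have "\<exists>\<delta>\<in>slopes. \<delta> \<notin> affine_slopes \<and> (\<forall>b\<in>B. shift_diff b \<delta> \<in> affine_slopes)"
    if "finite B" for B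
    using that
  proof induction
    case empty
    then show ?case using assms \<open>\<gamma> \<notin> affine_slopes\<close> by blast
  next
    case (insert b B)
    then obtain \<delta> where \<delta>: "\<delta> \<in> slopes" "\<delta> \<notin> affine_slopes"
      and B: "\<And>a. a \<in> B \<Longrightarrow> shift_diff a \<delta> \<in> affine_slopes" by blast
    \<comment> \<open>As \<open>\<delta>\<close> is not affine, the minimal \<open>n\<close> is
      positive; the iterate just before it is still not affine.\<close>
    define n where "n = (LEAST n. (shift_diff b ^^ n) \<delta> \<in> affine_slopes)"
    have "\<exists>n. (shift_diff b ^^ n) \<delta> \<in> affine_slopes"
      using shift_diff_nilpotent[OF \<delta>(1), of b] zero by metis
    then have n: "(shift_diff b ^^ n) \<delta> \<in> affine_slopes"
      unfolding n_def by (rule LeastI_ex)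
    then obtain m where m: "n = Suc m" using \<delta>(2) by (cases n) auto
    define \<epsilon> where "\<epsilon> = (shift_diff b ^^ m) \<delta>"
    have "\<epsilon> \<notin> affine_slopes"
      unfolding \<epsilon>_def by (rule not_less_Least) (use m n_def in simp)
    moreover have "\<epsilon> \<in> slopes"
      unfolding \<epsilon>_def by (induction m) (simp_all add: \<delta> shift_diff_slopes)
    moreover have "shift_diff b \<epsilon> \<in> affine_slopes" using n m by (simp add: \<epsilon>_def)
    moreover have "shift_diff a \<epsilon> \<in> affine_slopes" if "a \<in> B" for a
    proof -
      have "(shift_diff b ^^ j) (shift_diff a \<delta>) \<in> affine_slopes" for j
        by (induction j) (simp_all add: B[OF that] shift_diff_affine_slopes)
      then show ?thesis by (simp add: \<epsilon>_def shift_diff_funpow_commute)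
    qed
    ultimately show ?case by blast
  qed
  from this[OF finite_ring] show False using slopes_affine_if_shift_diff_affine by blast
qed

end

subsection \<open>Normalized automorphisms of the scheme\<close>

text \<open>Invariance of the relations enters as \<open>f_diff\<close>: \<open>(y, x)\<close> and
  \<open>(f y, f x)\<close> lie in a common relation.\<close>

locale normalized_map = pure_subgroup M V for M V :: "'a::comm_ring_1 set" +
  fixes K :: "'a set" and f :: "'a \<Rightarrow> 'a"
  assumes K_notin: "k \<in> K \<Longrightarrow> k \<notin> M"
    and K_mult: "k \<in> K \<Longrightarrow> l \<in> K \<Longrightarrow> k * l \<in> K"
    and K_inverse: "k \<in> K \<Longrightarrow> \<exists>l\<in>K. k * l = 1"
    and V_iff: "m \<in> M \<Longrightarrow> m \<in> V \<longleftrightarrow> 1 + m \<in> K"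
    and f_0: "f 0 = 0"
    and f_1: "f 1 = 1"
    and f_diff: "\<exists>k\<in>K. f x - f y = (x - y) * k"
begin

lemma K_rinv: "k \<in> K \<Longrightarrow> rinv k \<in> K"
  using K_inverse[of k] rinv_unique[of k] by auto

lemma f_diff_mem_iff: "f x - f y \<in> M \<longleftrightarrow> x - y \<in> M"
proof -
  obtain k where "k \<in> K" "f x - f y = (x - y) * k" using f_diff by blast
  then show ?thesis using K_notin mult_mem_iff by simp
qed

lemma f_mem_iff: "f x \<in> M \<longleftrightarrow> x \<in> M"
  using f_diff_mem_iff[of x 0] by (simp add: f_0)

lemma bij_f: "bij f"
proof -
  have "inj f"
  proof (rule injI)
    fix x y assume "f x = f y"
    moreover obtain k where k: "k \<in> K" "f x - f y = (x - y) * k" using f_diff by blast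
    ultimately have "(x - y) * (k * rinv k) = 0" by (simp add: mult.assoc[symmetric])
    then show "x = y" using rinv_right[OF K_notin[OF k(1)]] by simp
  qed
  then show ?thesis using finite_UNIV_inj_surj[OF finite_ring] by (simp add: bij_def)
qed

lemma V_pure_f:
  assumes "\<And>b. f b * m \<in> V"
  shows "m = 0"
proof (rule V_pure)
  fix r
  obtain b where "r = f b" using bij_f by (meson bij_pointE)
  then show "r * m \<in> V" using assms by simp
qed

section \<open>Increments of \<open>f\<close> along the radical\<close>

lemma ex_increment:
  assumes n: "n \<in> M"
  shows "\<exists>m\<in>M. f (x + m) - f x = n"
proof -
  obtain y where y: "f x + n = f y" using bij_f by (meson bij_pointE)
  then have "f y - f x \<in> M" using n by (metis add_diff_cancel_left')
  then have "y - x \<in> M" by (simp add: f_diff_mem_iff)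
  moreover have "f (x + (y - x)) - f x = n" by (simp add: y[symmetric])
  ultimately show ?thesis by blast
qed

lemma increment_mem: "m \<in> M \<Longrightarrow> f (x + m) - f x \<in> M"
  by (simp add: f_diff_mem_iff)

text \<open>The differences from \<open>f (x - u)\<close> to \<open>f x\<close> and to
  \<open>f (x + m)\<close> have multipliers \<open>k\<close>, \<open>k2\<close> in \<open>K\<close>.
  As products in \<open>M\<close> vanish, \<open>k2 / k\<close> is \<open>1\<close> plus the
  displayed element.\<close>

lemma increment_congruence:
  assumes m: "m \<in> M" and u: "u \<notin> M"
  shows "rinv (f x - f (x - u)) * (f (x + m) - f x) - rinv u * m \<in> V"
proof -
  define w n where "w = f x - f (x - u)" and "n = f (x + m) - f x"
  define U where "U = rinv u"
  have uU: "u * U = 1" by (simp add: U_def rinv_right[OF u])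
  have nM: "n \<in> M" using increment_mem[OF m] by (simp add: n_def)
  obtain k where k: "k \<in> K" "w = u * k" using f_diff[of x "x - u"] by (auto simp: w_def)
  define L where "L = rinv k"
  have kL: "k * L = 1" by (simp add: L_def rinv_right K_notin k)
  have "w * (U * L) = (u * U) * (k * L)" by (simp add: k ac_simps)
  then have W: "rinv w = U * L" by (intro rinv_unique) (simp add: uU kL)
  obtain k2 where k2: "k2 \<in> K" "w + n = (u + m) * k2"
    using f_diff[of "x + m" "x - u"] by (auto simp: w_def n_def algebra_simps)
  have "(u + m) * (U - U * U * m) = u * U + m * U * (1 - u * U) - U * U * (m * m)"
    by (simp add: algebra_simps)
  then have inv: "(u + m) * (U - U * U * m) = 1" by (simp add: uU mult_eq_0 m)
  have "k2 * L = ((u + m) * (U - U * U * m)) * (k2 * L)" by (simp add: inv)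
  also have "\<dots> = ((u + m) * k2) * ((U - U * U * m) * L)" by (simp add: ac_simps)
  also have "\<dots> = (u * k + n) * ((U - U * U * m) * L)" by (simp only: k2(2)[symmetric] k(2))
  also have "\<dots> = (u * U) * (k * L) - (u * U) * (k * L) * (U * m) + (U * L) * n - (n * m) * (U * U * L)"
    by (simp add: algebra_simps)
  also have "\<dots> = 1 + ((U * L) * n - U * m)"
    by (simp add: uU kL mult_eq_0[OF nM m])
  finally have "k2 * L = 1 + (rinv w * n - U * m)" by (simp only: W)
  moreover have "k2 * L \<in> K" using K_mult[OF k2(1) K_rinv[OF k(1)]] by (simp add: L_def)
  moreover have "rinv w * n - U * m \<in> M" using nM m by (simp add: mem_intros)
  ultimately have "rinv w * n - U * m \<in> V" using V_iff by simp
  then show ?thesis by (simp add: w_def n_def U_def)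
qed

text \<open>The value \<open>0\<close> on \<open>M\<close> makes additivity modulo \<open>M\<close>
  hold also when a sum of units falls into \<open>M\<close>.\<close>

definition h :: "'a \<Rightarrow> 'a \<Rightarrow> 'a" where
  "h x b = (if b \<in> M then 0 else rinv (f x - f (x - rinv b)))"

lemma h_mult: "b \<notin> M \<Longrightarrow> h x b * (f x - f (x - rinv b)) = 1"
  by (simp add: h_def rinv_left f_diff_mem_iff rinv_notin)

lemma h_increment:
  assumes m: "m \<in> M"
  shows "h x b * (f (x + m) - f x) - b * m \<in> V"
proof (cases "b \<in> M")
  case True
  then show ?thesis using mult_eq_0 m V_zero by (simp add: h_def)
next
  case False
  then show ?thesis
    using increment_congruence[OF m rinv_notin[OF False], of x] by (simp add: h_def rinv_rinv)
qed

text \<open>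
  For each increment \<open>n = f (x + m) - f x\<close>, \<open>h x b * n\<close> agrees modulo \<open>V\<close> with the additive
  function \<open>b * m\<close> of \<open>b\<close>; since \<open>n\<close> is arbitrary in \<open>M\<close> and \<open>V\<close> is pure, \<open>h x\<close> is additive
  modulo \<open>M\<close>.
\<close>

lemma h_add: "h x (b + c) - h x b - h x c \<in> M"
proof (rule ccontr)
  define z where "z = h x (b + c) - h x b - h x c"
  assume "h x (b + c) - h x b - h x c \<notin> M"
  then have z: "z \<notin> M" by (simp add: z_def)
  obtain m0 where m0: "m0 \<in> M" "m0 \<noteq> 0" using ex_nonzero by blast
  have "r * m0 \<in> V" for r
  proof -
    obtain m where m: "m \<in> M" and n: "f (x + m) - f x = rinv z * (r * m0)"
      using ex_increment[of "rinv z * (r * m0)" x] mult_mem m0 by blast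
    define n where "n = f (x + m) - f x"
    have "(h x (b + c) * n - (b + c) * m) - (h x b * n - b * m) - (h x c * n - c * m) \<in> V"
      unfolding n_def by (intro V_diff h_increment m)
    also have "(h x (b + c) * n - (b + c) * m) - (h x b * n - b * m) - (h x c * n - c * m) = z * n"
      by (simp add: z_def algebra_simps)
    also have "z * n = z * rinv z * (r * m0)" by (simp only: n_def n mult.assoc)
    finally show ?thesis by (simp add: rinv_right[OF z])
  qed
  then have "m0 = 0" by (rule V_pure)
  then show False using m0 by simp
qed

section \<open>Additivity of \<open>f\<close> modulo \<open>M\<close>\<close>

lemma minus_notin: "x \<notin> M \<Longrightarrow> - x \<notin> M"
  using uminus_mem[of "- x"] by auto

lemma h_0_uminus: "h 0 a + h 0 (- a) \<in> M"
  using uminus_mem[OF h_add[of 0 a "- a"]] by (simp add: h_def[of 0 0] zero_mem add.commute)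

lemma rinv_minus: "x \<notin> M \<Longrightarrow> rinv (- x) = - rinv x"
  by (rule rinv_unique) (simp add: rinv_right)

lemma h_0_minus_one: "h 0 (- 1) = - 1"
  using h_mult[OF minus_notin[OF one_notin], of 0] rinv_unique[of 1 1]
  by (simp add: rinv_minus one_notin f_0 f_1 minus_equation_iff)

lemma h_0_one: "h 0 1 - 1 \<in> M"
  using h_0_uminus[of 1] by (simp add: h_0_minus_one)

text \<open>By definition \<open>h 0 (- 1 / a)\<close> is \<open>- 1 / f a\<close>, and
  \<open>h 0\<close> is odd modulo \<open>M\<close>.\<close>

lemma h_0_rinv:
  assumes a: "a \<notin> M"
  shows "h 0 (rinv a) * f a - 1 \<in> M"
proof -
  have "h 0 (- rinv a) * (- f a) = 1"
    using h_mult[OF minus_notin[OF rinv_notin[OF a]], of 0]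
    by (simp add: rinv_minus rinv_notin rinv_rinv a f_0)
  then have "h 0 (rinv a) * f a - 1 = (h 0 (rinv a) + h 0 (- rinv a)) * f a"
    by (simp add: distrib_right minus_equation_iff)
  then show ?thesis using mult_mem'[OF h_0_uminus] by simp
qed

text \<open>For \<open>a = b - 1\<close> one has \<open>1 - 1 / b = 1 / (1 + 1 / a)\<close>.
  Additivity of \<open>h 0\<close> makes \<open>f\<close> of this congruent to
  \<open>f a / (1 + f a)\<close>, and one minus that has inverse \<open>1 + f a\<close>.\<close>

lemma h_1_eq: "h 1 b - f (b - 1) - 1 \<in> M"
proof (cases "b \<in> M")
  case True
  have "h 0 (rinv (- 1)) * f (- 1) - 1 \<in> M" by (rule h_0_rinv[OF minus_notin[OF one_notin]])
  moreover have "rinv (- 1) = - 1" by (rule rinv_unique) simp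
  ultimately have 1: "- f (- 1) - 1 \<in> M" by (simp add: h_0_minus_one)
  have 2: "f (- 1) - f (b - 1) \<in> M" using True by (simp add: f_diff_mem_iff uminus_mem)
  have "- f (b - 1) - 1 = (- f (- 1) - 1) + (f (- 1) - f (b - 1))" by simp
  then have "- f (b - 1) - 1 \<in> M" using add_mem[OF 1 2] by (simp only:)
  then show ?thesis using True by (simp add: h_def)
next
  case b: False
  define y where "y = f (1 - rinv b)"
  have hy: "h 1 b * (1 - y) = 1" using h_mult[OF b, of 1] by (simp add: y_def f_1)
  define a where "a = b - 1"
  show ?thesis
  proof (cases "a \<in> M")
    case True
    have "1 - rinv b = rinv b * a" by (simp add: a_def right_diff_distrib rinv_left[OF b])
    then have "y \<in> M" unfolding y_def f_mem_iff using True mult_mem by simp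
    then have "h 1 b * y - f a \<in> M" using True by (intro diff_mem mult_mem) (simp_all add: f_mem_iff)
    also have "h 1 b * y - f a = h 1 b - f a - h 1 b * (1 - y)" by (simp add: algebra_simps)
    finally show ?thesis by (simp only: hy a_def)
  next
    case False
    have "(1 - rinv b) * (1 + rinv a) = 1 + rinv a - rinv b - rinv a * rinv b"
      by (simp add: algebra_simps)
    also have "\<dots> = 1 + (rinv a * (b * rinv b) - rinv b * (a * rinv a)) - rinv a * rinv b"
      by (simp add: rinv_right b False add_diff_eq)
    also have "\<dots> = 1" by (simp add: a_def algebra_simps)
    finally have inv: "(1 - rinv b) * (1 + rinv a) = 1" .
    then have notin: "1 - rinv b \<notin> M" using mult_mem' one_notin by metis
    define H where "H = h 0 (1 + rinv a)"
    define r where "r = h 0 (rinv a)"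
    have 1: "H * y - 1 \<in> M"
      using h_0_rinv[OF notin] by (simp add: H_def y_def rinv_unique[OF inv])
    have 2: "H - h 0 1 - r \<in> M" using h_add by (simp add: H_def r_def)
    have 3: "r * f a - 1 \<in> M" using h_0_rinv[OF False] by (simp add: r_def)
    have "(H - h 0 1 - r) * f a + (h 0 1 - 1) * f a + (r * f a - 1) \<in> M"
      by (intro add_mem mult_mem' 2 3 h_0_one)
    also have "(H - h 0 1 - r) * f a + (h 0 1 - 1) * f a + (r * f a - 1) = H * f a - f a - 1"
      by (simp add: algebra_simps)
    finally have 4: "H * f a - f a - 1 \<in> M" .
    \<comment> \<open>Eliminating \<open>H\<close> gives \<open>(1 - y) * (f a + 1)\<close>
      congruent to \<open>1\<close>; the factor \<open>h 1 b\<close> inverts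
      \<open>1 - y\<close>.\<close>
    have "h 1 b * ((H * y - 1) * f a - y * (H * f a - f a - 1)) \<in> M"
      by (intro mult_mem diff_mem mult_mem' 1 4)
    also have "(H * y - 1) * f a - y * (H * f a - f a - 1) = 1 - (1 - y) * (f a + 1)"
      by (simp add: algebra_simps)
    also have "h 1 b * (1 - (1 - y) * (f a + 1)) = h 1 b - (h 1 b * (1 - y)) * (f a + 1)"
      by (simp add: algebra_simps)
    finally show ?thesis by (simp only: hy mult_1 a_def diff_diff_eq)
  qed
qed

text \<open>Modulo \<open>M\<close>, \<open>f\<close> is \<open>h 1\<close> with argument and value
  shifted by one; \<open>h 1 1\<close>, congruent to \<open>1\<close>, compensates for the
  shift.\<close>

lemma f_add_mod: "f (x + y) - f x - f y \<in> M"
proof -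
  define s where "s = x + y + 1"
  have 1: "h 1 (s + 1) - h 1 (x + 1) - h 1 (y + 1) \<in> M"
    using h_add[of 1 "x + 1" "y + 1"] by (simp add: s_def algebra_simps)
  have 2: "h 1 (s + 1) - h 1 s - h 1 1 \<in> M" by (rule h_add)
  have 3: "h 1 1 - 1 \<in> M" using h_1_eq[of 1] by (simp add: f_0)
  have 4: "h 1 s - f (x + y) - 1 \<in> M" using h_1_eq[of s] by (simp add: s_def)
  have 5: "h 1 (x + 1) - f x - 1 \<in> M" "h 1 (y + 1) - f y - 1 \<in> M"
    using h_1_eq[of "x + 1"] h_1_eq[of "y + 1"] by simp_all
  have "(h 1 (s + 1) - h 1 (x + 1) - h 1 (y + 1)) - (h 1 (s + 1) - h 1 s - h 1 1)
      - (h 1 1 - 1) - (h 1 s - f (x + y) - 1) + (h 1 (x + 1) - f x - 1) + (h 1 (y + 1) - f y - 1) \<in> M"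
    by (intro add_mem diff_mem 1 2 3 4 5)
  then show ?thesis by (simp add: algebra_simps)
qed

lemma f_diff_mod: "f (x - y) - (f x - f y) \<in> M"
  using uminus_mem[OF f_add_mod[of "x - y" y]] by (simp add: algebra_simps)

lemma f_cong: "x - y \<in> M \<Longrightarrow> f x - f y \<in> M"
  by (simp add: f_diff_mem_iff)

section \<open>Multiplicativity of \<open>f\<close> modulo \<open>M\<close>\<close>

text \<open>
  The identity \<open>c / (a * (c - a)) = 1 / a + 1 / (c - a)\<close> turns additivity of \<open>f\<close> and of
  \<open>1 / f (1 / b)\<close> into \<open>f (a\<^sup>2 / c) = f (a)\<^sup>2 / f (c)\<close>, all modulo \<open>M\<close>.
\<close>

lemma f_square_div_mod:
  assumes a: "a \<notin> M" and c: "c \<notin> M"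
  shows "f (a * a * rinv c) * f c - f a * f a \<in> M"
proof (cases "c - a \<in> M")
  case True
  have "a * a * rinv c - a * (c * rinv c) = - ((c - a) * (a * rinv c))"
    by (simp add: algebra_simps)
  then have "a * a * rinv c - a \<in> M"
    using mult_mem'[OF True] uminus_mem rinv_right[OF c] by simp
  then have 1: "f (a * a * rinv c) - f a \<in> M" by (rule f_cong)
  have 2: "f c - f a \<in> M" using True by (rule f_cong)
  have "(f (a * a * rinv c) - f a) * f c + f a * (f c - f a) \<in> M"
    by (intro add_mem mult_mem[OF 2] mult_mem'[OF 1])
  then show ?thesis by (simp add: algebra_simps)
next
  case False
  \<comment> \<open>\<open>e\<close> is the inverse of \<open>1 / a + 1 / (c - a)\<close> and also a
    difference, so both additivity statements apply to it.\<close>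
  define e where "e = a * (c - a) * rinv c"
  have e: "e = a - a * a * rinv c"
  proof -
    have "e = a * (c * rinv c) - a * a * rinv c" by (simp add: e_def algebra_simps)
    then show ?thesis by (simp add: rinv_right[OF c])
  qed
  define A B where "A = rinv a" and "B = rinv (c - a)"
  have aA: "a * A = 1" and aB: "(c - a) * B = 1"
    by (simp_all add: A_def B_def rinv_right a False)
  have "e * (A + B) = (a * A) * (c - a) * rinv c + a * ((c - a) * B) * rinv c"
    by (simp add: e_def algebra_simps)
  also have "\<dots> = c * rinv c" unfolding aA aB by (simp add: algebra_simps)
  finally have eAB: "e * (A + B) = 1" by (simp add: rinv_right[OF c])
  have eM: "e \<notin> M" using a c False by (simp add: e_def mult_notin rinv_notin)
  define p q r where "p = h 0 A" and "q = h 0 B" and "r = h 0 (A + B)"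
  have 1: "p * f a - 1 \<in> M" using h_0_rinv[OF a] by (simp add: p_def A_def)
  have 2: "q * f (c - a) - 1 \<in> M" using h_0_rinv[OF False] by (simp add: q_def B_def)
  have 3: "r * f e - 1 \<in> M" using h_0_rinv[OF eM] rinv_unique[OF eAB] by (simp add: r_def)
  have 4: "r - p - q \<in> M" unfolding p_def q_def r_def by (rule h_add)
  have 5: "f (c - a) - (f c - f a) \<in> M" by (rule f_diff_mod)
  have 6: "f e - (f a - f (a * a * rinv c)) \<in> M" unfolding e by (rule f_diff_mod)
  define F G where "F = f a" and "G = f c - f a"
  have 7: "q * G - 1 \<in> M"
  proof -
    have "(q * f (c - a) - 1) - q * (f (c - a) - G) \<in> M"
      unfolding G_def by (intro diff_mem mult_mem 2 5)
    then show ?thesis by (simp add: algebra_simps)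
  qed
  \<comment> \<open>Modulo \<open>M\<close>, \<open>p\<close>, \<open>q\<close>, \<open>r\<close>
    invert \<open>F\<close>, \<open>G\<close>, \<open>f e\<close>; eliminating them from
    \<open>r = p + q\<close> leaves \<open>F * G = f e * (F + G)\<close>.\<close>
  have "f e * ((r - p - q) * (F * G) + (p * F - 1) * G + (q * G - 1) * F) - (r * f e - 1) * (F * G)
      + (f e - (F - f (a * a * rinv c))) * (F + G) \<in> M"
    unfolding F_def by (intro add_mem diff_mem mult_mem mult_mem' 1 3 4 6 7)
  also have "f e * ((r - p - q) * (F * G) + (p * F - 1) * G + (q * G - 1) * F) - (r * f e - 1) * (F * G)
      + (f e - (F - f (a * a * rinv c))) * (F + G) = F * G - (F - f (a * a * rinv c)) * (F + G)"
    by (simp add: algebra_simps)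
  also have "\<dots> = f (a * a * rinv c) * f c - f a * f a"
    by (simp add: F_def G_def algebra_simps)
  finally show ?thesis .
qed

lemma f_rinv_mod:
  assumes c: "c \<notin> M"
  shows "f (rinv c) * f c - 1 \<in> M"
  using f_square_div_mod[OF one_notin c] by (simp add: f_1)

lemma f_square_mult_mod: "f (a * a * d) - f a * f a * f d \<in> M"
proof (cases "a \<in> M \<or> d \<in> M")
  case True
  then have "f (a * a * d) \<in> M" "f a * f a * f d \<in> M"
    by (auto simp: f_mem_iff mult_mem_iff)
  then show ?thesis by (rule diff_mem)
next
  case False
  then have a: "a \<notin> M" and d: "d \<notin> M" by auto
  define c where "c = rinv d"
  have c: "c \<notin> M" "rinv c = d" using d by (simp_all add: c_def rinv_notin rinv_rinv)
  have 1: "f (a * a * d) * f c - f a * f a \<in> M" using f_square_div_mod[OF a c(1)] by (simp add: c)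
  have 2: "f d * f c - 1 \<in> M" using f_rinv_mod[OF c(1)] by (simp add: c)
  have "(f (a * a * d) * f c - f a * f a) * f d - (f d * f c - 1) * f (a * a * d) \<in> M"
    by (intro diff_mem mult_mem' 1 2)
  then show ?thesis by (simp add: algebra_simps)
qed

text \<open>The order \<open>n\<close> is odd, as an even \<open>n\<close> would lie in
  \<open>M\<close> together with \<open>n + 1\<close>. Hence \<open>g ^ k\<close> is congruent to
  the even power \<open>g ^ (k * (n + 1))\<close>.\<close>

lemma ex_sqrt_mod:
  assumes two: "2 \<in> M" and b: "b \<notin> M"
  shows "\<exists>c. b - c * c \<in> M"
proof -
  obtain g n where gen: "\<And>u. u \<notin> M \<Longrightarrow> \<exists>k. u - g ^ k \<in> M"
    and gn: "g ^ n - 1 \<in> M" and n: "of_nat n + 1 \<in> M"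
    using ex_residue_primitive_root by blast
  have "odd n"
  proof
    assume "even n"
    then obtain j where "n = 2 * j" ..
    then have "of_nat n \<in> M" using mult_mem'[OF two] by simp
    then show False using diff_mem[OF n] one_notin by fastforce
  qed
  then obtain j where j: "n = 2 * j + 1" by (elim oddE)
  obtain k where k: "b - g ^ k \<in> M" using gen b by blast
  have gnk: "(g ^ n) ^ k - 1 \<in> M"
    using power_diff_1_eq[of "g ^ n" k] mult_mem'[OF gn] by simp
  define c where "c = g ^ (k * (j + 1))"
  have "c * c = (g ^ n) ^ k * g ^ k"
    by (simp add: c_def j power_add[symmetric] power_mult[symmetric] algebra_simps mult_2_right)
  then have "b - c * c = (b - g ^ k) - ((g ^ n) ^ k - 1) * g ^ k" by (simp add: algebra_simps)
  then have "b - c * c \<in> M" using diff_mem[OF k mult_mem'[OF gnk]] by (simp only:)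
  then show ?thesis by blast
qed

text \<open>In residue characteristic two every unit is a square modulo \<open>M\<close>; otherwise
  compatibility with squares is polarized through \<open>a + b\<close>.\<close>

lemma f_mult_mod: "f (a * b) - f a * f b \<in> M"
proof (cases "2 \<in> M")
  case True
  show ?thesis
  proof (cases "b \<in> M")
    case True
    then have "f (a * b) \<in> M" "f a * f b \<in> M" by (auto simp: f_mem_iff mult_mem_iff)
    then show ?thesis by (rule diff_mem)
  next
    case False
    then obtain c where c: "b - c * c \<in> M" using ex_sqrt_mod True by blast
    have 1: "f b - f (c * c) \<in> M" using c by (rule f_cong)
    have 2: "f (c * c) - f c * f c \<in> M" using f_square_mult_mod[of c 1] by (simp add: f_1)
    have 3: "f (c * c * a) - f c * f c * f a \<in> M" by (rule f_square_mult_mod)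
    have "a * b - c * c * a = a * (b - c * c)" by (simp add: algebra_simps)
    then have 4: "f (a * b) - f (c * c * a) \<in> M" using mult_mem[OF c] by (intro f_cong) simp
    have "(f (a * b) - f (c * c * a)) + (f (c * c * a) - f c * f c * f a)
        - f a * (f (c * c) - f c * f c) - f a * (f b - f (c * c)) \<in> M"
      by (intro add_mem diff_mem mult_mem 1 2 3 4)
    then show ?thesis by (simp add: algebra_simps)
  qed
next
  case False
  have sq: "f (x * x) - f x * f x \<in> M" for x using f_square_mult_mod[of x 1] by (simp add: f_1)
  define s where "s = a + b"
  have 1: "f s - f a - f b \<in> M" unfolding s_def by (rule f_add_mod)
  have ss: "s * s = a * a + (a * b + a * b) + b * b" by (simp add: s_def algebra_simps)
  have 2: "f (s * s) - f (a * a + (a * b + a * b)) - f (b * b) \<in> M" unfolding ss by (rule f_add_mod)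
  have 3: "f (a * a + (a * b + a * b)) - f (a * a) - f (a * b + a * b) \<in> M" by (rule f_add_mod)
  have 4: "f (a * b + a * b) - f (a * b) - f (a * b) \<in> M" by (rule f_add_mod)
  have "(f (s * s) - f s * f s) - (f (s * s) - f (a * a + (a * b + a * b)) - f (b * b))
      - (f (a * a + (a * b + a * b)) - f (a * a) - f (a * b + a * b))
      - (f (a * b + a * b) - f (a * b) - f (a * b))
      - (f (a * a) - f a * f a) - (f (b * b) - f b * f b)
      + (f s + f a + f b) * (f s - f a - f b) \<in> M"
    by (intro add_mem diff_mem mult_mem 1 2 3 4 sq)
  then have "2 * (f (a * b) - f a * f b) \<in> M" by (simp add: algebra_simps)
  then show ?thesis using False mult_mem_iff by blast
qed

section \<open>Exact identities on the radical\<close>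

lemma f_increment:
  assumes m: "m \<in> M"
  shows "f b * (f (x + m) - f x) - b * m \<in> V"
proof -
  define n where "n = f (x + m) - f x"
  have n: "n \<in> M" using increment_mem[OF m] by (simp add: n_def)
  \<comment> \<open>For a unit \<open>b\<close>, \<open>f x - f (x - 1 / b)\<close> is congruent to
    \<open>f (1 / b)\<close>, hence to \<open>1 / f b\<close>. As \<open>M\<close> annihilates
    \<open>n\<close>, \<open>f b\<close> may replace \<open>h x b\<close> in
    \<open>h_increment\<close>.\<close>
  have "h x b - f b \<in> M"
  proof (cases "b \<in> M")
    case True
    then show ?thesis by (simp add: h_def f_mem_iff uminus_mem)
  next
    case False
    define w where "w = f x - f (x - rinv b)"
    have hw: "h x b * w = 1" unfolding w_def by (rule h_mult[OF False])
    have 1: "f (rinv b) - w \<in> M"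
      using f_diff_mod[of x "x - rinv b"] by (simp add: w_def)
    have 2: "f (rinv b) * f b - 1 \<in> M" by (rule f_rinv_mod[OF False])
    have "h x b * (f b * (f (rinv b) - w) - (f (rinv b) * f b - 1)) \<in> M"
      by (intro mult_mem diff_mem 1 2)
    also have "h x b * (f b * (f (rinv b) - w) - (f (rinv b) * f b - 1)) = h x b - f b * (h x b * w)"
      by (simp add: algebra_simps)
    finally show ?thesis by (simp add: hw)
  qed
  then have "(h x b - f b) * n = 0" using mult_eq_0 n by blast
  then have "f b * n = h x b * n" by (simp add: left_diff_distrib)
  then show ?thesis using h_increment[OF m, of x b] by (simp add: n_def)
qed

text \<open>The term \<open>b * m\<close> in \<open>f_increment\<close> is independent of
  \<open>x\<close>, so purity identifies the increments at \<open>x\<close> and at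
  \<open>0\<close>.\<close>

lemma f_add_rad:
  assumes m: "m \<in> M"
  shows "f (x + m) = f x + f m"
proof -
  have "f b * ((f (x + m) - f x) - (f (0 + m) - f 0)) \<in> V" for b
  proof -
    have "f b * ((f (x + m) - f x) - (f (0 + m) - f 0))
        = (f b * (f (x + m) - f x) - b * m) - (f b * (f (0 + m) - f 0) - b * m)"
      by (simp add: algebra_simps)
    then show ?thesis using V_diff[OF f_increment[OF m] f_increment[OF m]] by (simp only:)
  qed
  then have "(f (x + m) - f x) - (f (0 + m) - f 0) = 0" by (rule V_pure_f)
  then show ?thesis by (simp add: f_0 algebra_simps)
qed

text \<open>Modulo \<open>V\<close>, \<open>f b * f (s * m)\<close> and
  \<open>f (b * s) * f m\<close> both equal \<open>b * s * m\<close>, and \<open>f (b * s)\<close>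
  acts on \<open>M\<close> as \<open>f b * f s\<close>.\<close>

lemma f_mult_rad:
  assumes m: "m \<in> M"
  shows "f (s * m) = f s * f m"
proof -
  have fm: "f m \<in> M" using m by (simp add: f_mem_iff)
  have "f b * (f (s * m) - f s * f m) \<in> V" for b
  proof -
    have 1: "f b * f (s * m) - b * (s * m) \<in> V"
      using f_increment[OF mult_mem[OF m], of b 0 s] by (simp add: f_0)
    have 2: "f (b * s) * f m - b * s * m \<in> V"
      using f_increment[OF m, of "b * s" 0] by (simp add: f_0)
    have "(f (b * s) - f b * f s) * f m = 0" by (rule mult_eq_0[OF f_mult_mod fm])
    then have "f (b * s) * f m = f b * f s * f m" by (simp add: left_diff_distrib)
    then show ?thesis using V_diff[OF 1 2] by (simp add: algebra_simps)
  qed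
  then have "f (s * m) - f s * f m = 0" by (rule V_pure_f)
  then show ?thesis by simp
qed

text \<open>In the variable \<open>f x\<close>, \<open>g x - f x\<close> has slopes
  \<open>k1 / k2 - 1\<close> with \<open>k1\<close>, \<open>k2\<close> in \<open>K\<close>; for unit
  \<open>x - y\<close> these lie in \<open>M\<close>, hence in \<open>V\<close>. Then
  \<open>slopes_affine\<close> applies.\<close>

lemma compare_maps:
  assumes mem: "\<And>x. g x - f x \<in> M"
    and diff: "\<And>x y. \<exists>k\<in>K. g x - g y = (x - y) * k"
    and rad: "\<And>x m. m \<in> M \<Longrightarrow> g (x + m) = g x + f m"
  shows "\<exists>v\<in>V. \<forall>x. g x - f x = g 0 + f x * v"
proof -
  define \<gamma> where "\<gamma> = (\<lambda>y. g (inv_into UNIV f y) - y)"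
  have \<gamma>f: "\<gamma> (f x) = g x - f x" for x
    by (simp add: \<gamma>_def inv_f_f[OF bij_is_inj[OF bij_f]])
  have "\<exists>v\<in>V. \<gamma> (f x) - \<gamma> (f y) = (f x - f y) * v" for x y
  proof (cases "x - y \<in> M")
    case True
    have "\<gamma> (f x) = \<gamma> (f y)"
      unfolding \<gamma>f using rad[OF True, of y] f_add_rad[OF True, of y] by simp
    then show ?thesis using V_zero by force
  next
    case False
    obtain k1 where k1: "k1 \<in> K" "g x - g y = (x - y) * k1" using diff by blast
    obtain k2 where k2: "k2 \<in> K" "f x - f y = (x - y) * k2" using f_diff by blast
    define k where "k = k1 * rinv k2"
    have k: "k \<in> K" unfolding k_def by (intro K_mult K_rinv k1 k2)
    have "(f x - f y) * k = (x - y) * k1 * (k2 * rinv k2)" by (simp add: k2 k_def ac_simps)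
    then have "g x - g y = (f x - f y) * k" by (simp add: k1 rinv_right[OF K_notin[OF k2(1)]])
    then have eq: "\<gamma> (f x) - \<gamma> (f y) = (f x - f y) * (k - 1)" by (simp add: \<gamma>f algebra_simps)
    have "\<gamma> (f x) - \<gamma> (f y) \<in> M" unfolding \<gamma>f by (intro diff_mem mem)
    then have "k - 1 \<in> M" using False by (simp add: eq mult_mem_iff f_diff_mem_iff)
    then have "k - 1 \<in> V" using V_iff k by simp
    then show ?thesis using eq by blast
  qed
  then have "\<gamma> \<in> slopes"
    unfolding slopes_def using mem \<gamma>f bij_f by (auto simp: bij_pointE) (metis bij_pointE)+
  then have "\<gamma> \<in> affine_slopes" by (rule slopes_affine)
  then obtain c v where v: "v \<in> V" "\<gamma> = (\<lambda>y. c + y * v)" by (auto simp: affine_slopes_def)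
  then have eq: "g x - f x = c + f x * v" for x using \<gamma>f[of x] by simp
  have "c = g 0" using eq[of 0] by (simp add: f_0)
  then show ?thesis using eq v(1) by blast
qed

text \<open>For a unit \<open>s\<close>, the map \<open>f (s * x) / f s\<close> again fixes
  \<open>0\<close> and \<open>1\<close>, so its affine deviation from \<open>f\<close>
  vanishes.\<close>

lemma f_mult: "f (s * x) = f s * f x"
proof (cases "s \<in> M")
  case True
  then show ?thesis using f_mult_rad[of s x] by (simp add: mult.commute)
next
  case False
  define t where "t = rinv (f s)"
  have ft: "f s * t = 1" "t * f s = 1" using False by (simp_all add: t_def rinv_right rinv_left f_mem_iff)
  define g where "g = (\<lambda>x. t * f (s * x))"
  have "\<exists>v\<in>V. \<forall>x. g x - f x = g 0 + f x * v"
  proof (rule compare_maps)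
    fix x y
    have "t * (f (s * x) - f s * f x) \<in> M" by (intro mult_mem f_mult_mod)
    moreover have "t * (f (s * x) - f s * f x) = g x - (t * f s) * f x"
      by (simp add: g_def algebra_simps)
    ultimately show "g x - f x \<in> M" by (simp add: ft)
    obtain k1 where k1: "k1 \<in> K" "f (s * x) - f (s * y) = (s * x - s * y) * k1" using f_diff by blast
    obtain k2 where k2: "k2 \<in> K" "f s = s * k2" using f_diff[of s 0] by (auto simp: f_0)
    have 1: "k2 * rinv k2 = 1" by (rule rinv_right[OF K_notin[OF k2(1)]])
    have "g x - g y = t * (f (s * x) - f (s * y))" by (simp add: g_def right_diff_distrib)
    also have "\<dots> = t * ((s * x - s * y) * k1) * (k2 * rinv k2)" by (simp add: k1 1)
    also have "\<dots> = (t * (s * k2)) * ((x - y) * (k1 * rinv k2))" by (simp add: algebra_simps)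
    also have "\<dots> = (x - y) * (k1 * rinv k2)" by (simp add: k2(2)[symmetric] ft)
    finally show "\<exists>k\<in>K. g x - g y = (x - y) * k" using K_mult K_rinv k1 k2 by blast
  next
    fix x m assume m: "m \<in> M"
    have "f (s * (x + m)) = f (s * x) + f s * f m"
      using f_add_rad[OF mult_mem[OF m], of "s * x" s] f_mult_rad[OF m] by (simp add: distrib_left)
    then have "g (x + m) = g x + (t * f s) * f m" by (simp add: g_def algebra_simps)
    then show "g (x + m) = g x + f m" by (simp add: ft)
  qed
  moreover have "g 0 = 0" "g 1 = 1" by (simp_all add: g_def f_0 ft)
  ultimately obtain v where v: "\<And>x. g x - f x = f x * v" by auto
  then have "v = 0" using v[of 1] \<open>g 1 = 1\<close> by (simp add: f_1)
  then have "t * f (s * x) = f x" using v[of x] by (simp add: g_def)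
  then have "(f s * t) * f (s * x) = f s * f x" by (simp only: mult.assoc)
  then show ?thesis by (simp add: ft)
qed

text \<open>Comparison with translates gives \<open>f (x + s) - f s - f x = f x * v s\<close>. By
  symmetry \<open>v s = f s * v 1\<close>, and purity forces \<open>v = 0\<close>.\<close>

lemma f_add: "f (x + y) = f x + f y"
proof -
  have "\<exists>v\<in>V. \<forall>x. f (x + s) - f s - f x = f x * v" for s
  proof -
    define g where "g = (\<lambda>x. f (x + s) - f s)"
    have "\<exists>v\<in>V. \<forall>x. g x - f x = g 0 + f x * v"
    proof (rule compare_maps)
      fix x y
      show "g x - f x \<in> M" using f_add_mod[of x s] by (simp add: g_def algebra_simps)
      show "\<exists>k\<in>K. g x - g y = (x - y) * k" using f_diff[of "x + s" "y + s"] by (simp add: g_def)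
    next
      fix x m assume m: "m \<in> M"
      show "g (x + m) = g x + f m"
        using f_add_rad[OF m, of "x + s"] by (simp add: g_def algebra_simps)
    qed
    then show ?thesis by (simp add: g_def f_0)
  qed
  then obtain v where V: "\<And>s. v s \<in> V" and v: "\<And>s x. f (x + s) - f s - f x = f x * v s"
    by metis
  have sym: "f x * v s = f s * v x" for x s
  proof -
    have "f x * v s = f (x + s) - f s - f x" by (simp only: v)
    also have "\<dots> = f (s + x) - f x - f s" by (simp add: algebra_simps)
    finally show ?thesis by (simp only: v)
  qed
  have "f s * v 1 \<in> V" for s using sym[of 1 s] V[of s] by (simp add: f_1)
  then have "v 1 = 0" by (rule V_pure_f)
  then have "v y = 0" using sym[of 1 y] by (simp add: f_1)
  then show ?thesis using v[of x y] by (simp add: algebra_simps)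
qed

lemma f_ring_aut: "f \<in> ring_aut"
  using bij_f f_1 f_add f_mult by (simp add: ring_aut_def)

end

subsection \<open>Normality\<close>

lemma is_ideal_principal: "is_ideal (range ((*) (x::'a::comm_ring_1)))"
  unfolding is_ideal_def
proof (intro conjI ballI allI)
  show "0 \<in> range ((*) x)" by (rule range_eqI[of _ _ 0]) simp
next
  fix a b assume "a \<in> range ((*) x)" "b \<in> range ((*) x)"
  then show "a + b \<in> range ((*) x)" by (auto simp: distrib_left[symmetric])
next
  fix a assume "a \<in> range ((*) x)"
  then show "- a \<in> range ((*) x)" by (auto simp: mult_minus_right[symmetric] simp del: mult_minus_right)
next
  fix r a assume "a \<in> range ((*) x)"
  then show "r * a \<in> range ((*) x)" by (auto simp: mult.left_commute[of r x])
qed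

lemma ideal_with_one: "is_ideal I \<Longrightarrow> 1 \<in> I \<Longrightarrow> I = UNIV"
  unfolding is_ideal_def by (metis UNIV_eq_I mult.right_neutral)

lemma ex_maximal_ideal:
  assumes fin: "finite (UNIV :: 'a::comm_ring_1 set)"
    and I: "is_ideal I" "I \<noteq> (UNIV :: 'a set)"
  shows "\<exists>M. maximal_ideal M \<and> I \<subseteq> M"
proof -
  let ?S = "{J. is_ideal J \<and> J \<noteq> (UNIV :: 'a set) \<and> I \<subseteq> J}"
  have "finite ?S" using fin by (rule rev_finite_subset[OF finite_Pow_iff[THEN iffD2]]) auto
  then obtain M where M: "M \<in> ?S" "\<And>J. J \<in> ?S \<Longrightarrow> M \<subseteq> J \<Longrightarrow> J = M"
    using finite_has_maximal[of ?S] I by (metis (mono_tags, lifting) empty_iff mem_Collect_eq order_refl)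
  then show ?thesis unfolding maximal_ideal_def by blast
qed

lemma square_zero_local_rad:
  assumes fin: "finite (UNIV :: 'a::comm_ring_1 set)"
    and loc: "local_ring TYPE('a)"
    and nf: "\<not> is_field_ring TYPE('a)"
    and sq: "ideal_prod (rad :: 'a set) rad = {0}"
  shows "square_zero_local (rad :: 'a set)"
proof -
  have uniq: "\<exists>!M::'a set. maximal_ideal M" using loc by (simp add: local_ring_def)
  have max: "maximal_ideal (rad :: 'a set)" unfolding rad_def by (rule theI'[OF uniq])
  then have ideal: "is_ideal (rad :: 'a set)" and proper: "rad \<noteq> (UNIV :: 'a set)"
    by (simp_all add: maximal_ideal_def)
  have unit: "x dvd 1 \<longleftrightarrow> x \<notin> rad" for x :: 'a
  proof
    assume "x dvd 1"
    then obtain y where "1 = y * x" by (metis dvdE mult.commute)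
    moreover have "1 \<notin> (rad :: 'a set)" using ideal_with_one[OF ideal] proper by blast
    ultimately show "x \<notin> rad" using ideal unfolding is_ideal_def by metis
  next
    assume x: "x \<notin> rad"
    show "x dvd 1"
    proof (rule ccontr)
      assume "\<not> x dvd 1"
      then have "range ((*) x) \<noteq> UNIV" by (metis UNIV_I dvdI imageE)
      then obtain M where "maximal_ideal M" "range ((*) x) \<subseteq> M"
        using ex_maximal_ideal[OF fin is_ideal_principal] by blast
      moreover from this have "M = rad" using uniq max by blast
      moreover have "x \<in> range ((*) x)" by (rule range_eqI[of _ _ 1]) simp
      ultimately show False using x by blast
    qed
  qed
  have prod: "x * y = 0" if "x \<in> rad" "y \<in> rad" for x y :: 'a
  proof -
    have "x * y \<in> ideal_prod rad rad" unfolding ideal_prod_def using that by blast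
    then show ?thesis by (simp add: sq)
  qed
  obtain x :: 'a where "x \<noteq> 0" "\<not> x dvd 1" using nf by (auto simp: is_field_ring_def)
  then show ?thesis
    using ideal unit prod fin by unfold_locales (auto simp: is_ideal_def)
qed

text \<open>Since \<open>(1 + v) * (1 - w) = 1 + (v - w)\<close> on \<open>M\<close>, the group
  \<open>K\<close> induces an additive group; purity is applied to principal ideals.\<close>

lemma pure_subgroup_kernel:
  assumes "square_zero_local M" and K: "units_subgroup K" and pure: "pure K"
  shows "pure_subgroup M {m \<in> M. 1 + m \<in> K}"
proof -
  interpret square_zero_local M by fact
  have mul: "x * y \<in> K" if "x \<in> K" "y \<in> K" for x y
    using K that by (simp add: units_subgroup_def)
  show ?thesis
  proof unfold_locales
    show "0 \<in> {m \<in> M. 1 + m \<in> K}" using K zero_mem by (simp add: units_subgroup_def)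
  next
    fix v w assume v: "v \<in> {m \<in> M. 1 + m \<in> K}" and w: "w \<in> {m \<in> M. 1 + m \<in> K}"
    obtain y where y: "y \<in> K" "(1 + w) * y = 1" using K w unfolding units_subgroup_def by blast
    have "(1 + w) * (1 - w) = 1 - w * w" by (simp add: algebra_simps)
    then have "(1 + w) * (1 - w) = 1" using mult_eq_0 w by simp
    then have "y = 1 - w" using rinv_unique y(2) by metis
    then have "(1 + v) * (1 - w) \<in> K" using mul v y by auto
    moreover have "(1 + v) * (1 - w) = 1 + (v - w) - v * w" by (simp add: algebra_simps)
    ultimately show "v - w \<in> {m \<in> M. 1 + m \<in> K}" using mult_eq_0[of v w] v w diff_mem by simp
  next
    fix m assume m: "\<And>r. r * m \<in> {m \<in> M. 1 + m \<in> K}"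
    have "\<forall>i\<in>range ((*) m). 1 + i \<in> K" using m by (auto simp: mult.commute)
    then have "range ((*) m) = {0}"
      using pure is_ideal_principal[of m] unfolding pure_def by blast
    moreover have "m \<in> range ((*) m)" by (rule range_eqI[of _ _ 1]) simp
    ultimately show "m = 0" by simp
  qed auto
qed

lemma cyc_aut_diff:
  assumes "f \<in> cyc_aut K" and "1 \<in> K"
  shows "\<exists>k\<in>K. f y - f x = (y - x) * k"
proof -
  have "(x, y) \<in> cyc_rel K (y - x)" using assms(2) by (force simp: cyc_rel_def)
  then have "(f x, f y) \<in> (\<lambda>(x, y). (f x, f y)) ` cyc_rel K (y - x)" by force
  also have "\<dots> = cyc_rel K (y - x)" using assms(1) by (auto simp: cyc_aut_def cyc_rels_def)
  finally show ?thesis by (auto simp: cyc_rel_def)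
qed

theorem theorem1p9:
  fixes K :: "'a::comm_ring_1 set"
  assumes "finite (UNIV :: 'a set)"
    and "local_ring TYPE('a)"
    and "\<not> is_field_ring TYPE('a)"
    and "ideal_prod (rad :: 'a set) rad = {0}"
    and "units_subgroup K"
    and "pure K"
  shows "cyc_normal K"
  unfolding cyc_normal_def
proof
  fix f assume f: "f \<in> cyc_aut K"
  have loc: "square_zero_local (rad :: 'a set)"
    using assms(1-4) by (rule square_zero_local_rad)
  interpret pure_subgroup rad "{m \<in> rad. 1 + m \<in> K}"
    using loc assms(5,6) by (rule pure_subgroup_kernel)
  have one: "1 \<in> K" and mul: "\<And>x y. x \<in> K \<Longrightarrow> y \<in> K \<Longrightarrow> x * y \<in> K"
    and inv: "\<And>x. x \<in> K \<Longrightarrow> \<exists>y\<in>K. x * y = 1" and units: "\<And>k. k \<in> K \<Longrightarrow> k \<notin> rad"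
    using assms(5) unit_iff by (auto simp: units_subgroup_def ring_units_def)
  define a where "a = f 1 - f 0"
  have aK: "a \<in> K" using cyc_aut_diff[OF f one, of 1 0] by (auto simp: a_def)
  \<comment> \<open>Dividing by \<open>a\<close> makes the map fix \<open>1\<close>, and
    \<open>a \<in> K\<close> keeps all multipliers in \<open>K\<close>.\<close>
  define \<sigma> where "\<sigma> = (\<lambda>x. rinv a * (f x - f 0))"
  have "normalized_map rad {m \<in> rad. 1 + m \<in> K} K \<sigma>"
  proof unfold_locales
    show "\<sigma> 0 = 0" "\<sigma> 1 = 1" using rinv_left[OF units[OF aK]] by (simp_all add: \<sigma>_def a_def)
    fix x y
    obtain k where k: "k \<in> K" "f x - f y = (x - y) * k" using cyc_aut_diff[OF f one] by blast
    obtain b where b: "b \<in> K" "a * b = 1" using inv aK by blast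
    have "\<sigma> x - \<sigma> y = b * (f x - f y)"
      using rinv_unique[OF b(2)] by (simp add: \<sigma>_def right_diff_distrib)
    also have "\<dots> = (x - y) * (k * b)" by (simp only: k ac_simps)
    finally show "\<exists>k\<in>K. \<sigma> x - \<sigma> y = (x - y) * k" using mul k b by blast
  qed (use units mul inv in auto)
  then have "\<sigma> \<in> ring_aut" by (rule normalized_map.f_ring_aut)
  moreover have "a \<in> ring_units" using aK assms(5) by (auto simp: units_subgroup_def)
  moreover have "f = (\<lambda>x. a * \<sigma> x + f 0)"
    using rinv_right[OF units[OF aK]] by (simp add: \<sigma>_def mult.assoc[symmetric])
  ultimately show "f \<in> AGammaL1" unfolding AGammaL1_def by blast
qed

end
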